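(* Let $m\ge 1$ be an integer, $I=\{1,\ldots,m\}$, let $(A_i)_{i\in I}$ be a family of maximally monotone operators on $X$, let $(\lambda_i)_{i\in I}$ be a family of strictly positive real numbers such that $\sum_{i\in I}\lambda_i=1$, let $j\in I$, and set $$A=\Big(\sum_{i\in I}\lambda_i(\operatorname{Id}+A_i)^{-1}\Big)^{-1}-\operatorname{Id}.$$ Then the following hold. (i) $A$ is maximally monotone. (ii) $\operatorname{dom}A\approx\sum_{i\in I}\lambda_i\operatorname{dom}A_i$. (iii) $\operatorname{ran}A\approx\sum_{i\in I}\lambda_i\operatorname{ran}A_i$. (iv) If $0\in\bigcap_{i\in I}\overline{\operatorname{ran}A_i}$, then $0\in\overline{\operatorname{ran}A}$. (v) If $0\in(\operatorname{int}\operatorname{ran}A_j)\cap\bigcap_{i\in I\setminus\{j\}}\overline{\operatorname{ran}A_i}$, then $0\in\operatorname{int}\operatorname{ran}A$. (vi) If $\operatorname{dom}A_j=X$, then $\operatorname{dom}A=X$. (vii) If $\operatorname{ran}A_j=X$, then $\operatorname{ran}A=X$.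
   Context: $X$ is a real Euclidean space (finite-dimensional real inner product space) with inner product $\langle\cdot,\cdot\rangle$. An operator $A\colon X\rightrightarrows X$ is set-valued: $Ax\subseteq X$ for every $x\in X$; its graph is $\{(x,x^* )\in X\times X: x^*\in Ax\}$, its domain is $\operatorname{dom}A=\{x\in X: Ax\ne\varnothing\}$, its range is $\operatorname{ran}A=\bigcup_{x\in X}Ax$, and $A^{-1}$ is the operator with $x\in A^{-1}x^*\Leftrightarrow x^*\in Ax$. Sums and scalar multiples of operators are defined pointwise (Minkowski), and $\operatorname{Id}$ is the identity operator. $A$ is monotone if $\langle x-y,x^*-y^*\rangle\ge0$ for all $(x,x^* ),(y,y^* )$ in its graph, and maximally monotone if it is monotone and its graph is not properly contained in the graph of another monotone operator. For $C\subseteq X$, $\overline C$ is the closure, $\operatorname{int}C$ the interior, and $\operatorname{ri}C$ the relative interior, i.e., the interior of $C$ relative to its affine hull. Subsets $C,D$ of $X$ are nearly equal, written $C\approx D$, if $\overline C=\overline D$ and $\operatorname{ri}C=\operatorname{ri}D$. *)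

theory Defs
  imports "HOL-Analysis.Analysis"
begin

text \<open>
  Minkowski sums of sets, both binary and indexed, are those of \<^theory>\<open>HOL-Library.Set_Algebras\<close>.
  The library's \<open>-\<close> on sets and on set-valued functions is (pointwise) set difference, so the
  difference of operators is introduced separately, as a sum with a scalar multiple.
\<close>

type_synonym 'a operator = "'a \<Rightarrow> 'a set"

definition op_graph :: "'a operator \<Rightarrow> ('a \<times> 'a) set" where
  "op_graph A = {(x, u). u \<in> A x}"

definition op_dom :: "'a operator \<Rightarrow> 'a set" where
  "op_dom A = {x. A x \<noteq> {}}"

definition op_ran :: "'a operator \<Rightarrow> 'a set" where
  "op_ran A = (\<Union>x. A x)"

definition op_inverse :: "'a operator \<Rightarrow> 'a operator" where
  "op_inverse A = (\<lambda>u. {x. u \<in> A x})"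

definition op_id :: "'a operator" where
  "op_id = (\<lambda>x. {x})"

definition op_add :: "'a::real_vector operator \<Rightarrow> 'a operator \<Rightarrow> 'a operator" where
  "op_add A B = (\<lambda>x. A x + B x)"

definition op_scale :: "real \<Rightarrow> 'a::real_vector operator \<Rightarrow> 'a operator" where
  "op_scale c A = (\<lambda>x. (*\<^sub>R) c ` A x)"

definition op_diff :: "'a::real_vector operator \<Rightarrow> 'a operator \<Rightarrow> 'a operator" where
  "op_diff A B = op_add A (op_scale (-1) B)"

definition op_sum :: "('i \<Rightarrow> 'a::real_vector operator) \<Rightarrow> 'i set \<Rightarrow> 'a operator" where
  "op_sum A I = (\<lambda>x. \<Sum>i\<in>I. A i x)"

definition monotone_operator :: "'a::real_inner operator \<Rightarrow> bool" where
  "monotone_operator A \<longleftrightarrow>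
     (\<forall>(x, u) \<in> op_graph A. \<forall>(y, v) \<in> op_graph A. (x - y) \<bullet> (u - v) \<ge> 0)"

definition maximally_monotone :: "'a::real_inner operator \<Rightarrow> bool" where
  "maximally_monotone A \<longleftrightarrow>
     monotone_operator A \<and> \<not> (\<exists>B. monotone_operator B \<and> op_graph A \<subset> op_graph B)"

definition nearly_equal :: "'a::euclidean_space set \<Rightarrow> 'a set \<Rightarrow> bool" where
  "nearly_equal C D \<longleftrightarrow> closure C = closure D \<and> rel_interior C = rel_interior D"

definition resolvent_average ::
    "'i set \<Rightarrow> ('i \<Rightarrow> real) \<Rightarrow> ('i \<Rightarrow> 'a::real_vector operator) \<Rightarrow> 'a operator" where
  "resolvent_average I w A =
     op_diff
       (op_inverse (op_sum (\<lambda>i. op_scale (w i) (op_inverse (op_add op_id (A i)))) I))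
       op_id"

end

theory Submission
  imports Defs
begin

text \<open>
  Passing from an operator \<open>A\<close> to its resolvent, the inverse of \<open>Id + A\<close>, identifies the maximally monotone
  operators with the firmly nonexpansive maps defined on the whole space. Under this identification, taking the
  resolvent average of operators becomes taking the convex combination \<open>J = \<Sum>i. w i T i\<close> of their resolvents
  \<open>T i\<close>. Firm nonexpansiveness survives convex combinations, which gives maximal monotonicity of the average.
  Moreover the domain of an operator is the range of its resolvent \<open>T\<close>, and its range is the range of
  \<open>Id - T\<close>, which is again firmly nonexpansive. Hence the statements about domains and about ranges are
  both instances of one fact on firmly nonexpansive maps: the range of \<open>J\<close> is nearly equal to
  the weighted sum \<open>S\<close> of the ranges of the \<open>T i\<close> (\<open>range_convex_combination_nearly_equal\<close>).

  That the resolvent of a maximally monotone operator is everywhere defined is the theorem \<open>Minty\<close>. It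
  amounts to finding, for every \<open>z\<close>, a pair \<open>(x, z - x)\<close> that is monotonically related to the whole graph. The
  points \<open>x\<close> for which this pair is related to a single element of the graph form a closed ball, so by compactness it
  suffices to treat finite subsets of the graph (\<open>finite_monotone_extension\<close>). There, \<open>x\<close> is read off from a
  maximiser of a concave quadratic function over a convex hull of finitely many points; this is the dual form
  of minimising the largest violation.

  The near equality follows the method of Brezis and Haraux. Trivially \<open>range J \<subseteq> S\<close>, so it
  suffices that every point \<open>y\<close> in the relative interior of the convex hull of \<open>S\<close> is a value of \<open>J\<close>
  (\<open>nearly_equal_between_rel_interior_and_hull\<close>). Solve the perturbed equation
  \<open>J z + e z = y\<close> for small \<open>e > 0\<close>. A firmly nonexpansive map \<open>T\<close> is rectangular, that is,
  \<open>z \<bullet> (T a - T z)\<close> is bounded above in \<open>z\<close>, and this passes to \<open>z \<bullet> (y' - J z)\<close> for all \<open>y'\<close> in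
  the convex hull of \<open>S\<close>. Testing with \<open>y' = y\<close> shows that \<open>e z\<close> tends to \<open>0\<close> with \<open>e\<close>, and testing with
  points \<open>y'\<close> around \<open>y\<close> bounds the component of \<open>z\<close> parallel to the affine hull of \<open>S\<close>, uniformly in \<open>e\<close>.
  The value \<open>J z\<close> depends on that component only, so compactness yields a solution for \<open>e = 0\<close>
  (\<open>rel_interior_subset_range\<close>). The remaining claims are elementary properties of weighted Minkowski sums,
  transported along near equality.
\<close>

section \<open>Extension of monotone relations\<close>

lemma linear_le_quadratic_imp_nonpos:
  fixes L M :: real
  assumes "\<And>t. 0 < t \<Longrightarrow> t \<le> 1 \<Longrightarrow> L * t \<le> M * t\<^sup>2"
  shows "L \<le> 0"
proof (rule ccontr)
  assume "\<not> L \<le> 0"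
  define t where "t = min 1 (L / (2 * (\<bar>M\<bar> + 1)))"
  have t: "0 < t" "t \<le> 1"
    using \<open>\<not> L \<le> 0\<close> by (auto simp: t_def)
  have "t \<le> L / (2 * (\<bar>M\<bar> + 1))" by (simp add: t_def)
  then have tL: "t * (2 * (\<bar>M\<bar> + 1)) \<le> L" by (subst (asm) pos_le_divide_eq) auto
  have "L * t \<le> (M * t) * t" using assms[OF t(1,2)] by (simp add: power2_eq_square mult.assoc)
  then have "L \<le> M * t" using t(1) by simp
  also have "\<dots> \<le> \<bar>M\<bar> * t" using t(1) by (intro mult_right_mono) auto
  also have "\<dots> < t * (2 * (\<bar>M\<bar> + 1))" using t(1) by (simp add: algebra_simps add_strict_increasing2)
  also have "\<dots> \<le> L" by (rule tL)
  finally show False by simp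
qed

text \<open>
  For a convex combination of points of a monotone relation, the average of the inner products dominates the
  inner product of the averages. The expression \<open>c - y \<bullet> v' - y' \<bullet> v + c'\<close> is symmetric in the two lifted points
  and affine in each of them, and on lifted elements of the relation it is \<open>(y - y') \<bullet> (v - v')\<close>.
  So its nonnegativity extends from the generators to the hull in one argument after the other;
  the claim is the diagonal case.
\<close>

lemma inner_le_on_lifted_hull:
  fixes G :: "('a::real_inner \<times> 'a) set"
  assumes mono: "\<And>y v y' v'. (y, v) \<in> G \<Longrightarrow> (y', v') \<in> G \<Longrightarrow> (y - y') \<bullet> (v - v') \<ge> 0"
    and p: "(y, v, c) \<in> convex hull ((\<lambda>(y, v). (y, v, y \<bullet> v)) ` G)"
  shows "y \<bullet> v \<le> c"
proof -
  let ?H = "convex hull ((\<lambda>(y, v). (y, v, y \<bullet> v)) ` G)"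
  have convex_section: "convex {(y, v, c). c - y \<bullet> v' - y' \<bullet> v + c' \<ge> 0}" for y' v' :: 'a and c' :: real
  proof -
    have "{(y, v, c). c - y \<bullet> v' - y' \<bullet> v + c' \<ge> 0} = {p. (- v', - y', 1) \<bullet> p \<ge> - c'}"
      by (auto simp: inner_prod_def inner_commute)
    then show ?thesis using convex_halfspace_ge[of "- c'" "(- v', - y', 1)"] by simp
  qed
  have half: "c - y \<bullet> v' - y' \<bullet> v + y' \<bullet> v' \<ge> 0" if "(y', v') \<in> G" "(y, v, c) \<in> ?H" for y v c y' v'
  proof -
    have "?H \<subseteq> {(y, v, c). c - y \<bullet> v' - y' \<bullet> v + y' \<bullet> v' \<ge> 0}"
    proof (intro hull_minimal convex_section, clarify)
      fix y v assume "(y, v) \<in> G"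
      from mono[OF this that(1)] show "y \<bullet> v - y \<bullet> v' - y' \<bullet> v + y' \<bullet> v' \<ge> 0"
        by (simp add: inner_diff_left inner_diff_right)
    qed
    then show ?thesis using that(2) by auto
  qed
  have "?H \<subseteq> {(y', v', c'). c' - y' \<bullet> v - y \<bullet> v' + c \<ge> 0}"
    using half[OF _ p]
    by (intro hull_minimal convex_section) (auto simp: algebra_simps)
  then have "c - y \<bullet> v - y \<bullet> v + c \<ge> 0" using p by auto
  then show ?thesis by simp
qed

text \<open>
  For a pair \<open>(y, v)\<close> let \<open>q x = - ((y - x) \<bullet> (v - (z - x)))\<close>, a quadratic in \<open>x\<close> with leading part \<open>x \<bullet> x\<close>.
  A convex combination of such quadratics is determined by the averages of \<open>y\<close>, \<open>v\<close> and \<open>y \<bullet> v\<close>, and its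
  minimal value, attained at \<open>(y - v + z) / 2\<close> for the averages \<open>y\<close> and \<open>v\<close>, is the function \<open>g\<close> below.
  At a maximiser of the concave function \<open>g\<close> over the hull, the first-order condition in the direction of
  each generator says that \<open>q x\<close> is at most the maximum of \<open>g\<close>, where \<open>x\<close> is the minimiser of the combination.
  Monotonicity makes \<open>g\<close> nonpositive.
\<close>

lemma finite_monotone_extension:
  fixes G :: "('a::euclidean_space \<times> 'a) set"
  assumes fin: "finite G"
    and mono: "\<And>y v y' v'. (y, v) \<in> G \<Longrightarrow> (y', v') \<in> G \<Longrightarrow> (y - y') \<bullet> (v - v') \<ge> 0"
  shows "\<exists>x. \<forall>(y, v) \<in> G. (y - x) \<bullet> (v - (z - x)) \<ge> 0"
proof (cases "G = {}")
  case False
  define H where "H = convex hull ((\<lambda>(y, v). (y, v, y \<bullet> v)) ` G)"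
  define g :: "'a \<times> 'a \<times> real \<Rightarrow> real"
    where "g = (\<lambda>(y, v, c). y \<bullet> z - c - ((y - v + z) \<bullet> (y - v + z)) / 4)"
  have "compact H" unfolding H_def using fin
    by (intro compact_convex_hull finite_imp_compact) auto
  moreover have "H \<noteq> {}" using False by (simp add: H_def)
  moreover have "continuous_on H g" unfolding g_def case_prod_unfold by (intro continuous_intros) auto
  ultimately obtain p where p: "p \<in> H" "\<And>q. q \<in> H \<Longrightarrow> g q \<le> g p"
    using continuous_attains_sup[of H g] by blast
  obtain y v c where pe: "p = (y, v, c)" by (cases p)
  define b where "b = y - v + z"
  define x where "x = b /\<^sub>R 2"
  have "y \<bullet> v \<le> c"
    using inner_le_on_lifted_hull[OF mono] p(1) unfolding H_def pe by blast
  moreover have "y \<bullet> z - y \<bullet> v - (b \<bullet> b) / 4 = - ((y + v - z) \<bullet> (y + v - z)) / 4"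
    unfolding b_def by (simp add: inner_diff_left inner_diff_right inner_add_left inner_add_right inner_commute field_simps)
  moreover have "(y + v - z) \<bullet> (y + v - z) \<ge> 0" by simp
  \<comment> \<open>Completing the square bounds \<open>g\<close> at the maximiser by minus a quarter of the squared norm of \<open>y + v - z\<close>.\<close>
  ultimately have neg: "y \<bullet> z - c - (b \<bullet> b) / 4 \<le> 0" by linarith
  have "(y' - x) \<bullet> (v' - (z - x)) \<ge> 0" if G: "(y', v') \<in> G" for y' v'
  proof -
    define d where "d = (y' - y) - (v' - v)"
    \<comment> \<open>The derivative of \<open>g\<close> at the maximiser in the direction of the generator lifted from \<open>(y', v')\<close>.\<close>
    define L where "L = (y' - y) \<bullet> z - (y' \<bullet> v' - c) - (b \<bullet> d) / 2"
    have "L \<le> 0"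
    proof (rule linear_le_quadratic_imp_nonpos)
      fix t :: real assume t: "0 < t" "t \<le> 1"
      let ?q = "(1 - t) *\<^sub>R p + t *\<^sub>R (y', v', y' \<bullet> v')"
      have "(y', v', y' \<bullet> v') \<in> H" unfolding H_def using G by (intro hull_inc) force
      then have "?q \<in> H" using p(1) t unfolding H_def
        by (intro convexD convex_convex_hull) auto
      then have "g ?q \<le> g p" by (rule p(2))
      moreover have "?q = (y + t *\<^sub>R (y' - y), v + t *\<^sub>R (v' - v), c + t * (y' \<bullet> v' - c))"
        by (simp add: pe algebra_simps)
      moreover have "g (y + t *\<^sub>R (y' - y), v + t *\<^sub>R (v' - v), c + t * (y' \<bullet> v' - c))
          = g p + L * t - (d \<bullet> d) / 4 * t\<^sup>2"
      proof -
        have e: "y + t *\<^sub>R (y' - y) - (v + t *\<^sub>R (v' - v)) + z = b + t *\<^sub>R d"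
          by (simp add: b_def d_def algebra_simps)
        have "(b + t *\<^sub>R d) \<bullet> (b + t *\<^sub>R d) = b \<bullet> b + 2 * t * (b \<bullet> d) + t\<^sup>2 * (d \<bullet> d)"
          by (simp add: inner_add_left inner_add_right inner_commute power2_eq_square algebra_simps)
        moreover have "(y + t *\<^sub>R (y' - y)) \<bullet> z = y \<bullet> z + t * ((y' - y) \<bullet> z)"
          by (simp add: inner_add_left)
        ultimately show ?thesis
          unfolding g_def pe prod.case e b_def[symmetric] L_def by (simp add: field_simps)
      qed
      ultimately show "L * t \<le> (d \<bullet> d) / 4 * t\<^sup>2" by simp
    qed
    have e: "y' - v' + z = b + d" by (simp add: b_def d_def)
    have "(y' - x) \<bullet> (v' - (z - x)) = y' \<bullet> v' - y' \<bullet> z + x \<bullet> (y' - v' + z) - x \<bullet> x"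
      by (simp add: inner_diff_left inner_diff_right inner_add_left inner_add_right inner_commute)
    also have "\<dots> = y' \<bullet> v' - y' \<bullet> z + (b \<bullet> b) / 4 + (b \<bullet> d) / 2"
      unfolding e by (simp add: x_def inner_add_right field_simps)
    also have "\<dots> = - L - (y \<bullet> z - c - (b \<bullet> b) / 4)"
      by (simp add: L_def inner_diff_left)
    finally show ?thesis using \<open>L \<le> 0\<close> neg by linarith
  qed
  then show ?thesis by auto
qed auto

text \<open>This is Thales' theorem: the segment from \<open>y\<close> to \<open>z - v\<close> is a diameter of the ball.\<close>

lemma monotone_related_set_eq_cball:
  fixes y v z :: "'a::euclidean_space"
  shows "{x. (y - x) \<bullet> (v - (z - x)) \<ge> 0} = cball ((y + (z - v)) /\<^sub>R 2) (norm (y - (z - v)) / 2)"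
proof -
  have "(y - x) \<bullet> (v - (z - x)) \<ge> 0 \<longleftrightarrow>
      (norm ((y + (z - v)) /\<^sub>R 2 - x))\<^sup>2 \<le> (norm (y - (z - v)) / 2)\<^sup>2" for x
  proof -
    define a where "a = z - v"
    have d: "(y + a) /\<^sub>R 2 - x = ((y - x) - (x - a)) /\<^sub>R 2"
      by (simp add: algebra_simps flip: scaleR_2)
    have "(norm ((y + a) /\<^sub>R 2 - x))\<^sup>2 = ((y - x) - (x - a)) \<bullet> ((y - x) - (x - a)) / 4"
      unfolding d by (simp add: power_divide power2_norm_eq_inner)
    moreover have "(norm (y - a) / 2)\<^sup>2 = ((y - x) + (x - a)) \<bullet> ((y - x) + (x - a)) / 4"
      by (simp add: power_divide power2_norm_eq_inner)
    moreover have "((y - x) + (x - a)) \<bullet> ((y - x) + (x - a)) - ((y - x) - (x - a)) \<bullet> ((y - x) - (x - a))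
        = 4 * ((y - x) \<bullet> (x - a))"
      by (simp only: inner_add_left inner_add_right inner_diff_left inner_diff_right inner_commute) algebra
    moreover have "(y - x) \<bullet> (v - (z - x)) = (y - x) \<bullet> (x - a)"
      by (simp add: a_def algebra_simps)
    ultimately show ?thesis unfolding a_def[symmetric] by (intro iffI; linarith)
  qed
  then show ?thesis
    by (simp add: cball_def dist_norm)
qed

lemma monotone_extension:
  fixes G :: "('a::euclidean_space \<times> 'a) set"
  assumes mono: "\<And>y v y' v'. (y, v) \<in> G \<Longrightarrow> (y', v') \<in> G \<Longrightarrow> (y - y') \<bullet> (v - v') \<ge> 0"
  shows "\<exists>x. \<forall>(y, v) \<in> G. (y - x) \<bullet> (v - (z - x)) \<ge> 0"
proof (cases "G = {}")
  case False
  then obtain y0 v0 where G0: "(y0, v0) \<in> G" by auto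
  define R where "R = (\<lambda>(y, v). {x. (y - x) \<bullet> (v - (z - x)) \<ge> 0})"
  have R: "compact (R q)" for q
    by (cases q) (simp add: R_def monotone_related_set_eq_cball)
  have "R (y0, v0) \<inter> \<Inter> (R ` G) \<noteq> {}"
  proof (rule compact_imp_fip[OF R])
    show "closed T" if "T \<in> R ` G" for T using that R compact_imp_closed by blast
    fix F assume "finite F" "F \<subseteq> R ` G"
    then obtain G' where G': "G' \<subseteq> G" "finite G'" "F = R ` G'"
      using finite_subset_image by metis
    have "\<exists>x. \<forall>(y, v) \<in> insert (y0, v0) G'. (y - x) \<bullet> (v - (z - x)) \<ge> 0"
      using G'(1,2) G0 by (intro finite_monotone_extension mono) auto
    then show "R (y0, v0) \<inter> \<Inter> F \<noteq> {}" unfolding G'(3) R_def by fastforce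
  qed
  then show ?thesis unfolding R_def by fastforce
qed auto

section \<open>Maximally monotone operators and firmly nonexpansive maps\<close>

lemma eq_0_if_inner_minus_self_nonneg:
  fixes a :: "'a::real_inner"
  assumes "a \<bullet> (- a) \<ge> 0"
  shows "a = 0"
proof -
  have "a \<bullet> a \<le> 0" using assms by simp
  then show ?thesis using inner_gt_zero_iff[of a] by linarith
qed

definition firmly_nonexpansive :: "('a::real_inner \<Rightarrow> 'a) \<Rightarrow> bool" where
  "firmly_nonexpansive T \<longleftrightarrow> (\<forall>x y. (norm (T x - T y))\<^sup>2 \<le> (x - y) \<bullet> (T x - T y))"

text \<open>
  The operator \<open>T\<inverse> - Id\<close>, the only one whose resolvent is \<open>T\<close>. Membership is stated as a fixed-point
  equation, which turns facts on operators into facts on \<open>T\<close> without passing through set arithmetic.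
\<close>

definition operator_of_resolvent :: "('a::real_vector \<Rightarrow> 'a) \<Rightarrow> 'a operator" where
  "operator_of_resolvent T = (\<lambda>x. {u. T (x + u) = x})"

text \<open>
  Maximality holds because \<open>T\<close> is total: an element \<open>(x, u)\<close> of a monotone extension is compared with the element
  \<open>(y, x + u - y)\<close> of the graph, where \<open>y = T (x + u)\<close>. Both have the same coordinate sum, so monotonicity
  forces \<open>x = y\<close>.
\<close>

lemma maximally_monotone_operator_of_resolvent:
  fixes T :: "'a::real_inner \<Rightarrow> 'a"
  assumes T: "firmly_nonexpansive T"
  shows "maximally_monotone (operator_of_resolvent T)"
  unfolding maximally_monotone_def
proof (intro conjI notI)
  let ?A = "operator_of_resolvent T"
  show "monotone_operator ?A"
    unfolding monotone_operator_def op_graph_def operator_of_resolvent_def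
  proof (clarsimp)
    fix x u y v assume "T (x + u) = x" "T (y + v) = y"
    then have "(norm (x - y))\<^sup>2 \<le> ((x + u) - (y + v)) \<bullet> (x - y)"
      using T unfolding firmly_nonexpansive_def by metis
    then show "0 \<le> (x - y) \<bullet> (u - v)"
      by (simp add: power2_norm_eq_inner inner_diff_left inner_diff_right
          inner_add_left inner_add_right inner_commute algebra_simps)
  qed
  assume "\<exists>B. monotone_operator B \<and> op_graph ?A \<subset> op_graph B"
  then obtain B where B: "monotone_operator B" "op_graph ?A \<subset> op_graph B" by blast
  then obtain x u where xu: "(x, u) \<in> op_graph B" "(x, u) \<notin> op_graph ?A" by auto
  define y where "y = T (x + u)"
  have "(y, x + u - y) \<in> op_graph ?A"
    by (simp add: op_graph_def operator_of_resolvent_def y_def)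
  then have "(x - y) \<bullet> (u - (x + u - y)) \<ge> 0"
    using B xu(1) unfolding monotone_operator_def by blast
  moreover have "u - (x + u - y) = - (x - y)" by simp
  ultimately have "x = y" using eq_0_if_inner_minus_self_nonneg[of "x - y"] by simp
  then show False using xu(2) by (simp add: op_graph_def operator_of_resolvent_def y_def)
qed

text \<open>
  Existence of the resolvent value at \<open>z\<close> is \<open>monotone_extension\<close> applied to the graph, the new pair being in the
  graph by maximality; uniqueness is once more the comparison of two pairs with the same coordinate sum.
\<close>

theorem Minty:
  fixes A :: "'a::euclidean_space operator"
  assumes A: "maximally_monotone A"
  obtains T where "firmly_nonexpansive T" "A = operator_of_resolvent T"
proof -
  have mono: "(x - y) \<bullet> (u - v) \<ge> 0" if "u \<in> A x" "v \<in> A y" for x y u v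
    using A that unfolding maximally_monotone_def monotone_operator_def op_graph_def by blast
  have ex: "\<exists>x. z - x \<in> A x" for z
  proof -
    obtain x where x: "\<And>y v. v \<in> A y \<Longrightarrow> (y - x) \<bullet> (v - (z - x)) \<ge> 0"
      using monotone_extension[of "op_graph A" z] mono by (auto simp: op_graph_def)
    define B where "B = A(x := insert (z - x) (A x))"
    have G: "op_graph B = insert (x, z - x) (op_graph A)"
      by (auto simp: op_graph_def B_def split: if_splits)
    have "(x - y) \<bullet> (z - x - v) \<ge> 0" if "v \<in> A y" for y v
      using x[OF that] by (simp add: inner_diff_left inner_diff_right)
    then have "monotone_operator B"
      using x mono unfolding monotone_operator_def G by (auto simp: op_graph_def)
    then have "\<not> op_graph A \<subset> op_graph B"
      using A unfolding maximally_monotone_def by blast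
    then have "(x, z - x) \<in> op_graph A" unfolding G by blast
    then show ?thesis by (auto simp: op_graph_def)
  qed
  define T where "T z = (SOME x. z - x \<in> A x)" for z
  have T: "z - T z \<in> A (T z)" for z unfolding T_def using someI_ex[OF ex] .
  have fne: "firmly_nonexpansive T" unfolding firmly_nonexpansive_def
  proof (intro allI)
    fix x y
    show "(norm (T x - T y))\<^sup>2 \<le> (x - y) \<bullet> (T x - T y)"
      using mono[OF T[of x] T[of y]]
      by (simp add: power2_norm_eq_inner inner_diff_left inner_diff_right inner_commute)
  qed
  have "T (x + u) = x" if "u \<in> A x" for x u
  proof -
    have "(x - T (x + u)) \<bullet> (u - (x + u - T (x + u))) \<ge> 0" by (rule mono[OF that T])
    moreover have "u - (x + u - T (x + u)) = - (x - T (x + u))" by simp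
    ultimately show ?thesis using eq_0_if_inner_minus_self_nonneg[of "x - T (x + u)"] by simp
  qed
  moreover have "u \<in> A x" if "T (x + u) = x" for x u using T[of "x + u"] that by simp
  ultimately have "A = operator_of_resolvent T" by (auto simp: operator_of_resolvent_def)
  with fne show ?thesis by (rule that)
qed

lemma op_dom_operator_of_resolvent: "op_dom (operator_of_resolvent T) = range T"
proof -
  have "x \<in> range T" if "T (x + u) = x" for x u using that by (intro range_eqI[of _ _ "x + u"]) simp
  moreover have "\<exists>u. T (T z + u) = T z" for z by (rule exI[of _ "z - T z"]) simp
  ultimately show ?thesis by (auto simp: op_dom_def operator_of_resolvent_def)
qed

lemma op_ran_operator_of_resolvent: "op_ran (operator_of_resolvent T) = range (\<lambda>x. x - T x)"
proof -
  have "u \<in> range (\<lambda>x. x - T x)" if "T (x + u) = x" for x u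
    using that by (intro range_eqI[of _ _ "x + u"]) simp
  moreover have "\<exists>y. T (y + (x - T x)) = y" for x by (rule exI[of _ "T x"]) simp
  ultimately show ?thesis by (auto simp: op_ran_def operator_of_resolvent_def)
qed

lemma resolvent_operator_of_resolvent:
  "op_inverse (op_add op_id (operator_of_resolvent T)) = (\<lambda>z. {T z})"
proof -
  have "(\<exists>u. T (x + u) = x \<and> z = x + u) \<longleftrightarrow> x = T z" for x z
    by (metis add.commute diff_add_cancel)
  then show ?thesis
    by (simp add: op_inverse_def op_add_def op_id_def operator_of_resolvent_def set_plus_def fun_eq_iff
        set_eq_iff)
qed

lemma op_diff_inverse_id:
  "op_diff (op_inverse (\<lambda>z. {T z})) op_id = operator_of_resolvent T"
proof (intro ext set_eqI)
  fix x u
  have "u \<in> op_diff (op_inverse (\<lambda>z. {T z})) op_id x \<longleftrightarrow> (\<exists>z. x = T z \<and> u = z - x)"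
    by (auto simp: op_inverse_def op_diff_def op_add_def op_id_def op_scale_def set_plus_def)
  also have "\<dots> \<longleftrightarrow> T (x + u) = x"
    by (metis add_diff_cancel_left' add.commute diff_add_cancel)
  finally show "u \<in> op_diff (op_inverse (\<lambda>z. {T z})) op_id x \<longleftrightarrow> u \<in> operator_of_resolvent T x"
    by (simp add: operator_of_resolvent_def)
qed

lemma resolvent_average_operator_of_resolvent:
  fixes T :: "'i \<Rightarrow> 'a::real_vector \<Rightarrow> 'a"
  assumes I: "finite I"
  shows "resolvent_average I w (\<lambda>i. operator_of_resolvent (T i))
    = operator_of_resolvent (\<lambda>x. \<Sum>i\<in>I. w i *\<^sub>R T i x)"
proof -
  have sum_singleton: "(\<Sum>i\<in>I. {f i}) = {\<Sum>i\<in>I. f i}" for f :: "'i \<Rightarrow> 'a"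
    using I by induction (simp_all add: set_plus_def set_zero)
  show ?thesis
    unfolding resolvent_average_def resolvent_operator_of_resolvent
    by (simp add: op_scale_def op_sum_def sum_singleton op_diff_inverse_id)
qed

section \<open>The range of a convex combination of firmly nonexpansive maps\<close>

lemma firmly_nonexpansiveD:
  "firmly_nonexpansive T \<Longrightarrow> (norm (T x - T y))\<^sup>2 \<le> (x - y) \<bullet> (T x - T y)"
  by (simp add: firmly_nonexpansive_def)

lemma firmly_nonexpansive_complement:
  assumes "firmly_nonexpansive T"
  shows "firmly_nonexpansive (\<lambda>x. x - T x)"
  unfolding firmly_nonexpansive_def
proof (intro allI)
  fix x y
  define d where "d = T x - T y"
  have "d \<bullet> d \<le> (x - y) \<bullet> d"
    using firmly_nonexpansiveD[OF assms, of x y] by (simp add: d_def power2_norm_eq_inner)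
  moreover have diff_eq: "x - T x - (y - T y) = (x - y) - d" by (simp add: d_def)
  ultimately show "(norm (x - T x - (y - T y)))\<^sup>2 \<le> (x - y) \<bullet> (x - T x - (y - T y))"
    unfolding diff_eq by (simp add: power2_norm_eq_inner inner_diff_left inner_diff_right inner_commute)
qed

lemma firmly_nonexpansive_nonexpansive:
  assumes "firmly_nonexpansive T"
  shows "norm (T x - T y) \<le> norm (x - y)"
proof -
  have "(norm (T x - T y))\<^sup>2 \<le> norm (x - y) * norm (T x - T y)"
    using firmly_nonexpansiveD[OF assms, of x y] norm_cauchy_schwarz order_trans by blast
  then show ?thesis by (cases "T x = T y") (auto simp: power2_eq_square)
qed

text \<open>
  The only inequality beyond linearity is convexity of the squared norm. It is obtained from the nonnegativity
  of the weighted variance of the differences \<open>d i\<close> about their mean \<open>m\<close>.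
\<close>

lemma firmly_nonexpansive_convex_combination:
  assumes w: "\<And>i. i \<in> I \<Longrightarrow> w i \<ge> 0" "sum w I = 1"
    and T: "\<And>i. i \<in> I \<Longrightarrow> firmly_nonexpansive (T i)"
  shows "firmly_nonexpansive (\<lambda>x. \<Sum>i\<in>I. w i *\<^sub>R T i x)"
  unfolding firmly_nonexpansive_def
proof (intro allI)
  fix x y
  define d where "d i = T i x - T i y" for i
  define m where "m = (\<Sum>i\<in>I. w i *\<^sub>R d i)"
  have "0 \<le> (\<Sum>i\<in>I. w i * ((d i - m) \<bullet> (d i - m)))"
    using w(1) by (intro sum_nonneg mult_nonneg_nonneg) auto
  also have "\<dots> = (\<Sum>i\<in>I. w i * (d i \<bullet> d i)) - 2 * (\<Sum>i\<in>I. w i * (d i \<bullet> m)) + (\<Sum>i\<in>I. w i * (m \<bullet> m))"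
    by (simp add: inner_diff_left inner_diff_right inner_commute algebra_simps sum.distrib
        sum_subtractf sum_distrib_left)
  also have "(\<Sum>i\<in>I. w i * (d i \<bullet> m)) = m \<bullet> m"
    by (simp add: m_def inner_sum_left)
  also have "(\<Sum>i\<in>I. w i * (m \<bullet> m)) = m \<bullet> m"
    using w(2) by (simp flip: sum_distrib_right)
  finally have "m \<bullet> m \<le> (\<Sum>i\<in>I. w i * (d i \<bullet> d i))" by simp
  also have "\<dots> \<le> (\<Sum>i\<in>I. w i * ((x - y) \<bullet> d i))"
    using w(1) firmly_nonexpansiveD[OF T, of _ x y]
    by (intro sum_mono mult_left_mono) (auto simp: d_def power2_norm_eq_inner)
  also have "\<dots> = (x - y) \<bullet> m" by (simp add: m_def inner_sum_right)
  finally show "(norm ((\<Sum>i\<in>I. w i *\<^sub>R T i x) - (\<Sum>i\<in>I. w i *\<^sub>R T i y)))\<^sup>2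
      \<le> (x - y) \<bullet> ((\<Sum>i\<in>I. w i *\<^sub>R T i x) - (\<Sum>i\<in>I. w i *\<^sub>R T i y))"
    by (simp add: m_def d_def power2_norm_eq_inner scaleR_diff_right sum_subtractf)
qed

text \<open>
  The reflection \<open>N = 2 T - Id\<close> is nonexpansive. Written in terms of \<open>N\<close>, the equation becomes
  \<open>(1 + 2 e) z = 2 y - N z\<close>, a fixed-point problem for a contraction.
\<close>

lemma firmly_nonexpansive_plus_scaled_id_surj:
  fixes T :: "'a::euclidean_space \<Rightarrow> 'a"
  assumes T: "firmly_nonexpansive T" and e: "e > 0"
  shows "\<exists>z. T z + e *\<^sub>R z = y"
proof -
  define f where "f z = (2 *\<^sub>R y - (2 *\<^sub>R T z - z)) /\<^sub>R (1 + 2 * e)" for z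
  have reflection: "norm ((2 *\<^sub>R T z - z) - (2 *\<^sub>R T z' - z')) \<le> norm (z - z')" for z z'
  proof (rule power2_le_imp_le)
    define d where "d = T z - T z'"
    have diff_eq: "(2 *\<^sub>R T z - z) - (2 *\<^sub>R T z' - z') = 2 *\<^sub>R d - (z - z')"
      by (simp add: d_def algebra_simps)
    have "d \<bullet> d \<le> (z - z') \<bullet> d"
      using firmly_nonexpansiveD[OF T, of z z'] by (simp add: d_def power2_norm_eq_inner)
    moreover have "(2 *\<^sub>R d - a) \<bullet> (2 *\<^sub>R d - a) = 4 * (d \<bullet> d - a \<bullet> d) + a \<bullet> a" for a
      by (simp add: inner_diff_left inner_diff_right inner_commute)
    ultimately show "(norm ((2 *\<^sub>R T z - z) - (2 *\<^sub>R T z' - z')))\<^sup>2 \<le> (norm (z - z'))\<^sup>2"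
      unfolding diff_eq power2_norm_eq_inner by simp
  qed simp
  have "dist (f z) (f z') \<le> (1 / (1 + 2 * e)) * dist z z'" for z z'
  proof -
    have "f z - f z' = (- ((2 *\<^sub>R T z - z) - (2 *\<^sub>R T z' - z'))) /\<^sub>R (1 + 2 * e)"
      unfolding f_def scaleR_diff_right[symmetric] by (rule arg_cong[of _ _ "scaleR _"]) simp
    then have "dist (f z) (f z') = norm ((2 *\<^sub>R T z - z) - (2 *\<^sub>R T z' - z')) / (1 + 2 * e)"
      using e by (simp only: dist_norm norm_scaleR norm_minus_cancel) (simp add: divide_inverse)
    also have "\<dots> \<le> norm (z - z') / (1 + 2 * e)"
      using e reflection by (intro divide_right_mono) auto
    finally show ?thesis by (simp add: dist_norm)
  qed
  then obtain z where z: "f z = z"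
    using banach_fix_type[of "1 / (1 + 2 * e)" f] e by auto
  have "(1 + 2 * e) *\<^sub>R f z = 2 *\<^sub>R y - (2 *\<^sub>R T z - z)"
    using e by (simp add: f_def)
  then have "2 *\<^sub>R (T z + e *\<^sub>R z) = 2 *\<^sub>R y"
    unfolding z by (simp add: algebra_simps)
  then show ?thesis by auto
qed

text \<open>
  The use of this is that moving the argument orthogonally to all differences of values of \<open>T\<close> does not
  change the value, so unbounded arguments can be replaced by their projections.
\<close>

lemma firmly_nonexpansive_eq_if_orthogonal:
  fixes T :: "'a::real_inner \<Rightarrow> 'a"
  assumes T: "firmly_nonexpansive T"
    and "(z - p) \<bullet> (T z - T p) = 0"
  shows "T z = T p"
  using firmly_nonexpansiveD[OF T, of z p] assms(2) by simp

text \<open>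
  The surjectivity principle of Brezis and Haraux. Solutions \<open>z\<close> of \<open>T z + e z = y0\<close> may be unbounded as
  \<open>e\<close> tends to \<open>0\<close>, but their projections \<open>p\<close> to the direction space \<open>L\<close> of the affine hull of \<open>C\<close> stay in a
  fixed ball, and \<open>T p = T z\<close>. So \<open>y0\<close> is a limit of values of \<open>T\<close> on a compact ball.
\<close>

lemma rel_interior_subset_range:
  fixes T :: "'a::euclidean_space \<Rightarrow> 'a"
  assumes T: "firmly_nonexpansive T"
    and TC: "range T \<subseteq> C"
    and bound: "\<And>y. y \<in> C \<Longrightarrow> \<exists>K. \<forall>z. z \<bullet> (y - T z) \<le> K"
  shows "rel_interior C \<subseteq> range T"
proof
  fix y0 assume "y0 \<in> rel_interior C"
  then obtain r where y0: "y0 \<in> C" and r: "r > 0" "cball y0 r \<inter> affine hull C \<subseteq> C"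
    unfolding mem_rel_interior_cball by blast
  define L where "L = (\<lambda>x. x - y0) ` (affine hull C)"
  have "subspace L" unfolding L_def
    using y0 by (intro affine_diffs_subspace_subtract affine_affine_hull hull_inc)
  then obtain B where B: "B \<subseteq> L" "pairwise orthogonal B" "\<And>b. b \<in> B \<Longrightarrow> norm b = 1"
      "independent B" "span B = L"
    using orthonormal_basis_subspace[of L] by metis
  obtain K where K: "\<And>y z. y \<in> C \<Longrightarrow> z \<bullet> (y - T z) \<le> K y"
    using bound by metis
  have in_C: "y0 + s *\<^sub>R b \<in> C" if "b \<in> B" "\<bar>s\<bar> \<le> r" for b s
  proof -
    have "s *\<^sub>R b \<in> L" using \<open>subspace L\<close> B(1) that(1) by (auto intro: subspace_scale)
    then have "y0 + s *\<^sub>R b \<in> affine hull C" unfolding L_def by (auto simp: add.commute)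
    moreover have "y0 + s *\<^sub>R b \<in> cball y0 r" using that B(3) by (simp add: dist_norm)
    ultimately show ?thesis using r(2) by blast
  qed
  \<comment> \<open>Testing with the points of \<open>C\<close> at distance \<open>r\<close> from \<open>y0\<close> in the directions \<open>b\<close> and \<open>- b\<close> will control the
    coordinate of \<open>z\<close> along \<open>b\<close>, whatever the size of the perturbation is.\<close>
  define R where "R = (\<Sum>b\<in>B. (\<bar>K (y0 + r *\<^sub>R b)\<bar> + \<bar>K (y0 + (- r) *\<^sub>R b)\<bar>) / r)"
  have "y0 \<in> closure (T ` cball 0 R)"
    unfolding closure_approachable
  proof (intro allI impI)
    fix \<delta> :: real assume \<delta>: "\<delta> > 0"
    \<comment> \<open>Testing with \<open>y0\<close> itself will bound the square of the error norm by \<open>e * K y0\<close>.\<close>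
    define e where "e = \<delta>\<^sup>2 / (\<bar>K y0\<bar> + 1)"
    have e: "e > 0" using \<delta> by (simp add: e_def)
    have eK: "e * K y0 < \<delta>\<^sup>2"
    proof -
      have "e * K y0 < e * (\<bar>K y0\<bar> + 1)" using e by (intro mult_strict_left_mono) auto
      also have "\<dots> = \<delta>\<^sup>2" by (simp add: e_def)
      finally show ?thesis .
    qed
    obtain z where z: "T z + e *\<^sub>R z = y0"
      using firmly_nonexpansive_plus_scaled_id_surj[OF T e] by blast
    have Kz: "z \<bullet> (y - y0) + e * (z \<bullet> z) \<le> K y" if "y \<in> C" for y
      using K[OF that, of z] unfolding z[symmetric] by (simp add: inner_diff_right inner_add_right)
    \<comment> \<open>The orthogonal projection of \<open>z\<close> to \<open>L\<close>, in the shape of \<open>Gram_Schmidt_step\<close>.\<close>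
    define p where "p = (\<Sum>b\<in>B. (b \<bullet> z / (b \<bullet> b)) *\<^sub>R b)"
    have "norm p \<le> (\<Sum>b\<in>B. norm ((b \<bullet> z / (b \<bullet> b)) *\<^sub>R b))"
      unfolding p_def by (rule norm_sum)
    also have "\<dots> \<le> R" unfolding R_def
    proof (rule sum_mono)
      fix b assume b: "b \<in> B"
      have zz: "e * (z \<bullet> z) \<ge> 0" using e by simp
      have "r * (z \<bullet> b) \<le> K (y0 + r *\<^sub>R b)" "- r * (z \<bullet> b) \<le> K (y0 + (- r) *\<^sub>R b)"
        using Kz[OF in_C[OF b, of r]] Kz[OF in_C[OF b, of "- r"]] r(1) zz by auto
      then have "\<bar>z \<bullet> b\<bar> * r \<le> \<bar>K (y0 + r *\<^sub>R b)\<bar> + \<bar>K (y0 + (- r) *\<^sub>R b)\<bar>"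
        using r(1) by (cases "z \<bullet> b \<ge> 0") (auto simp: mult.commute)
      then show "norm ((b \<bullet> z / (b \<bullet> b)) *\<^sub>R b) \<le>
          (\<bar>K (y0 + r *\<^sub>R b)\<bar> + \<bar>K (y0 + (- r) *\<^sub>R b)\<bar>) / r"
        using r(1) B(3)[OF b] by (simp add: pos_le_divide_eq inner_commute flip: power2_norm_eq_inner)
    qed
    finally have pR: "p \<in> cball 0 R" by simp
    have "T z - T p \<in> L"
    proof -
      have "T x \<in> affine hull C" for x using TC by (intro hull_inc) auto
      then have "T z - y0 \<in> L" "T p - y0 \<in> L" unfolding L_def by auto
      from subspace_diff[OF \<open>subspace L\<close> this] show ?thesis by simp
    qed
    then have "(T z - T p) \<bullet> (z - p) = 0"
      using Gram_Schmidt_step[OF B(2), of "T z - T p" z] B(5) by (simp add: p_def orthogonal_def)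
    then have "T z = T p"
      by (intro firmly_nonexpansive_eq_if_orthogonal[OF T]) (simp add: inner_commute)
    moreover have "dist (T z) y0 < \<delta>"
    proof -
      have "dist (T z) y0 = norm (e *\<^sub>R z)" unfolding z[symmetric] by (simp add: dist_norm)
      then have "(dist (T z) y0)\<^sup>2 = e * (e * (z \<bullet> z))"
        by (simp add: power_mult_distrib power2_norm_eq_inner) (simp add: power2_eq_square)
      also have "\<dots> \<le> e * K y0" using Kz[OF y0] e by (intro mult_left_mono) auto
      also have "\<dots> < \<delta>\<^sup>2" by (rule eK)
      finally show ?thesis using \<delta> by (simp add: power2_less_imp_less)
    qed
    ultimately show "\<exists>y\<in>T ` cball 0 R. dist y y0 < \<delta>" using pR by auto
  qed
  moreover have "continuous_on (cball 0 R) T"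
    using firmly_nonexpansive_nonexpansive[OF T]
    by (intro lipschitz_on_continuous_on[of 1] lipschitz_onI) (auto simp: dist_norm)
  then have "closed (T ` cball 0 R)"
    by (intro compact_imp_closed compact_continuous_image) auto
  ultimately show "y0 \<in> range T" by (auto simp: closure_closed)
qed

text \<open>
  With \<open>d = T a - T z\<close>, firm nonexpansiveness bounds the left side by \<open>|a| |d| - |d|\<^sup>2\<close>. The point is that
  the resulting bound does not depend on \<open>z\<close>.
\<close>

lemma firmly_nonexpansive_rectangular:
  fixes T :: "'a::real_inner \<Rightarrow> 'a"
  assumes T: "firmly_nonexpansive T"
  shows "z \<bullet> (T a - T z) \<le> (norm a)\<^sup>2 / 4"
proof -
  define d where "d = T a - T z"
  have "z \<bullet> d = a \<bullet> d - (a - z) \<bullet> d" by (simp add: inner_diff_left)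
  also have "\<dots> \<le> norm a * norm d - (norm d)\<^sup>2"
    using firmly_nonexpansiveD[OF T, of a z] norm_cauchy_schwarz[of a d] by (simp add: d_def)
  also have "\<dots> \<le> (norm a)\<^sup>2 / 4"
    using zero_le_power2[of "norm a / 2 - norm d"]
    by (simp add: power2_eq_square field_simps)
  finally show ?thesis by (simp add: d_def)
qed

lemma mem_sum_scaled_images_iff:
  fixes S :: "'i \<Rightarrow> 'a::real_vector set"
  assumes "finite I"
  shows "x \<in> (\<Sum>i\<in>I. (*\<^sub>R) (w i) ` S i) \<longleftrightarrow> (\<exists>s. (\<forall>i\<in>I. s i \<in> S i) \<and> x = (\<Sum>i\<in>I. w i *\<^sub>R s i))"
proof
  assume "x \<in> (\<Sum>i\<in>I. (*\<^sub>R) (w i) ` S i)"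
  then obtain t where t: "x = sum t I" "\<forall>i\<in>I. t i \<in> (*\<^sub>R) (w i) ` S i"
    unfolding set_sum_alt[OF assms] by auto
  then have "\<forall>i\<in>I. \<exists>s. s \<in> S i \<and> t i = w i *\<^sub>R s" by auto
  then obtain s where "\<forall>i\<in>I. s i \<in> S i \<and> t i = w i *\<^sub>R s i" by metis
  then show "\<exists>s. (\<forall>i\<in>I. s i \<in> S i) \<and> x = (\<Sum>i\<in>I. w i *\<^sub>R s i)"
    using t(1) by (intro exI[of _ s]) auto
next
  assume "\<exists>s. (\<forall>i\<in>I. s i \<in> S i) \<and> x = (\<Sum>i\<in>I. w i *\<^sub>R s i)"
  then show "x \<in> (\<Sum>i\<in>I. (*\<^sub>R) (w i) ` S i)"
    unfolding set_sum_alt[OF assms] by blast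
qed

text \<open>
  Every set between the relative interior of a convex set and that set has the same affine hull, hence the same
  relative interior, and the same closure. Both \<open>D\<close> and \<open>S\<close> are such sets for the convex hull of \<open>S\<close>.
\<close>

lemma nearly_equal_between_rel_interior_and_hull:
  fixes S :: "'a::euclidean_space set"
  assumes "D \<subseteq> S" "rel_interior (convex hull S) \<subseteq> D"
  shows "nearly_equal D S"
proof -
  let ?H = "convex hull S"
  have between: "rel_interior E = rel_interior ?H" if E: "rel_interior ?H \<subseteq> E" "E \<subseteq> ?H" for E
  proof -
    have "affine hull (rel_interior ?H) = affine hull ?H"
      by (simp add: rel_interior_same_affine_hull)
    then have aff: "affine hull E = affine hull ?H"
      using hull_mono[OF E(1), of affine] hull_mono[OF E(2), of affine] by simp
    have "rel_interior (rel_interior ?H) \<subseteq> rel_interior E"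
      using E(1) aff by (intro subset_rel_interior) (simp_all add: rel_interior_same_affine_hull)
    moreover have "rel_interior E \<subseteq> rel_interior ?H"
      using E(2) aff by (intro subset_rel_interior)
    ultimately show ?thesis by (simp add: rel_interior_rel_interior)
  qed
  have SH: "S \<subseteq> ?H" by (rule hull_subset)
  have "closure S \<subseteq> closure (rel_interior ?H)"
    using closure_mono[OF SH] by (simp add: convex_closure_rel_interior)
  then have "closure D = closure S"
    using assms closure_mono by blast
  moreover have "rel_interior D = rel_interior S"
    using between[of D] between[of S] assms SH by auto
  ultimately show ?thesis by (simp add: nearly_equal_def)
qed

text \<open>
  Let \<open>J\<close> be the convex combination. The points \<open>y\<close> for which \<open>z \<bullet> (y - J z)\<close> is bounded above in \<open>z\<close> form a
  convex set. It contains the weighted sum of the ranges, because there the expression splits into the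
  expressions bounded by \<open>firmly_nonexpansive_rectangular\<close>.
\<close>

theorem range_convex_combination_nearly_equal:
  fixes T :: "'i \<Rightarrow> 'a::euclidean_space \<Rightarrow> 'a"
  assumes I: "finite I"
    and w: "\<And>i. i \<in> I \<Longrightarrow> w i \<ge> 0" "sum w I = 1"
    and T: "\<And>i. i \<in> I \<Longrightarrow> firmly_nonexpansive (T i)"
  shows "nearly_equal (range (\<lambda>x. \<Sum>i\<in>I. w i *\<^sub>R T i x)) (\<Sum>i\<in>I. (*\<^sub>R) (w i) ` range (T i))"
proof (rule nearly_equal_between_rel_interior_and_hull)
  let ?J = "\<lambda>x. \<Sum>i\<in>I. w i *\<^sub>R T i x" and ?S = "\<Sum>i\<in>I. (*\<^sub>R) (w i) ` range (T i)"
  show sub: "range ?J \<subseteq> ?S"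
  proof (rule image_subsetI)
    fix x show "?J x \<in> ?S"
      unfolding mem_sum_scaled_images_iff[OF I] by (rule exI[of _ "\<lambda>i. T i x"]) simp
  qed
  show "rel_interior (convex hull ?S) \<subseteq> range ?J"
  proof (rule rel_interior_subset_range)
    show "firmly_nonexpansive ?J" by (rule firmly_nonexpansive_convex_combination[OF w T])
    show "range ?J \<subseteq> convex hull ?S" using sub hull_subset by fast
    let ?Y = "{y. \<exists>K. \<forall>z. z \<bullet> (y - ?J z) \<le> K}"
    have "?S \<subseteq> ?Y"
    proof
      fix y assume "y \<in> ?S"
      then obtain s where "\<forall>i\<in>I. s i \<in> range (T i)" and y: "y = (\<Sum>i\<in>I. w i *\<^sub>R s i)"
        unfolding mem_sum_scaled_images_iff[OF I] by blast
      then have "\<forall>i\<in>I. \<exists>a. s i = T i a" by blast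
      then obtain a where a: "\<forall>i\<in>I. s i = T i (a i)" by metis
      have "z \<bullet> (y - ?J z) \<le> (\<Sum>i\<in>I. w i * ((norm (a i))\<^sup>2 / 4))" for z
      proof -
        have "z \<bullet> (y - ?J z) = (\<Sum>i\<in>I. w i * (z \<bullet> (T i (a i) - T i z)))"
          using a by (simp add: y inner_diff_right inner_sum_right algebra_simps flip: sum_subtractf)
        also have "\<dots> \<le> (\<Sum>i\<in>I. w i * ((norm (a i))\<^sup>2 / 4))"
          using w(1) firmly_nonexpansive_rectangular[OF T] by (intro sum_mono mult_left_mono) auto
        finally show ?thesis .
      qed
      then show "y \<in> ?Y" by blast
    qed
    moreover have "convex ?Y"
    proof (rule convexI)
      fix y y' and s t :: real assume "y \<in> ?Y" "y' \<in> ?Y" and st: "0 \<le> s" "0 \<le> t" "s + t = 1"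
      then obtain K K' where K: "\<And>z. z \<bullet> (y - ?J z) \<le> K" "\<And>z. z \<bullet> (y' - ?J z) \<le> K'" by auto
      have "z \<bullet> (s *\<^sub>R y + t *\<^sub>R y' - ?J z) \<le> s * K + t * K'" for z
      proof -
        have "s *\<^sub>R y + t *\<^sub>R y' - ?J z = s *\<^sub>R (y - ?J z) + t *\<^sub>R (y' - ?J z)"
          using st(3) by (simp add: scaleR_diff_right flip: scaleR_add_left)
            (simp add: algebra_simps flip: scaleR_add_left)
        then have "z \<bullet> (s *\<^sub>R y + t *\<^sub>R y' - ?J z) = s * (z \<bullet> (y - ?J z)) + t * (z \<bullet> (y' - ?J z))"
          by (simp add: inner_add_right)
        also have "\<dots> \<le> s * K + t * K'"
          using K st by (intro add_mono mult_left_mono) auto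
        finally show ?thesis .
      qed
      then show "s *\<^sub>R y + t *\<^sub>R y' \<in> ?Y" by blast
    qed
    ultimately have "convex hull ?S \<subseteq> ?Y" by (rule hull_minimal)
    then show "\<exists>K. \<forall>z. z \<bullet> (y - ?J z) \<le> K" if "y \<in> convex hull ?S" for y using that by blast
  qed
qed

section \<open>Near equality and weighted Minkowski sums\<close>

lemma eq_UNIV_if_nearly_equal_UNIV:
  "nearly_equal D UNIV \<Longrightarrow> D = UNIV"
  using rel_interior_subset[of D] by (auto simp: nearly_equal_def)

lemma interior_subset_if_nearly_equal:
  assumes "nearly_equal D S"
  shows "interior S \<subseteq> interior D"
proof (cases "interior S = {}")
  case False
  then have "interior S = rel_interior D"
    using assms by (simp add: nearly_equal_def rel_interior_nonempty_interior)
  then have "interior S \<subseteq> D" using rel_interior_subset by blast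
  then show ?thesis by (intro interior_maximal) auto
qed simp

lemma sum_closure_subset_closure_sum:
  fixes S :: "'i \<Rightarrow> 'a::real_normed_vector set"
  assumes "finite I"
  shows "(\<Sum>i\<in>I. closure (S i)) \<subseteq> closure (\<Sum>i\<in>I. S i)"
  using assms
proof induction
  case empty
  then show ?case by (simp add: set_zero)
next
  case (insert i I)
  have "closure (S i) + (\<Sum>i\<in>I. closure (S i)) \<subseteq> closure (S i) + closure (\<Sum>i\<in>I. S i)"
    by (rule set_plus_mono2[OF order_refl insert.IH])
  also have "\<dots> \<subseteq> closure (S i + (\<Sum>i\<in>I. S i))" by (rule closure_sum)
  finally show ?case using insert by simp
qed

lemma zero_in_closure_sum_scaled:
  fixes S :: "'i \<Rightarrow> 'a::real_normed_vector set"
  assumes "finite I" and "\<And>i. i \<in> I \<Longrightarrow> 0 \<in> closure (S i)"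
  shows "0 \<in> closure (\<Sum>i\<in>I. (*\<^sub>R) (w i) ` S i)"
proof -
  have "0 \<in> (\<Sum>i\<in>I. (*\<^sub>R) (w i) ` closure (S i))"
    unfolding mem_sum_scaled_images_iff[OF assms(1)]
    using assms(2) by (intro exI[of _ "\<lambda>_. 0"]) simp
  then show ?thesis
    using sum_closure_subset_closure_sum[OF assms(1), of "\<lambda>i. (*\<^sub>R) (w i) ` S i"]
    by (auto simp: closure_scaleR)
qed

text \<open>
  A ball of radius \<open>r\<close> in \<open>S j\<close> contributes a ball of radius \<open>w j * r\<close> about \<open>0\<close>. The sum over the other indices
  contains a point \<open>s\<close> of norm less than half that radius, and the ball shifted by \<open>s\<close> still covers the ball
  about \<open>0\<close> of half the radius.
\<close>

lemma zero_in_interior_sum_scaled: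
  fixes S :: "'i \<Rightarrow> 'a::real_normed_vector set"
  assumes I: "finite I" "j \<in> I" and w: "w j > 0"
    and j: "0 \<in> interior (S j)"
    and closure: "\<And>i. i \<in> I - {j} \<Longrightarrow> 0 \<in> closure (S i)"
  shows "0 \<in> interior (\<Sum>i\<in>I. (*\<^sub>R) (w i) ` S i)"
proof -
  let ?W = "\<Sum>i\<in>I - {j}. (*\<^sub>R) (w i) ` S i"
  obtain r where r: "r > 0" "ball 0 r \<subseteq> S j"
    using j mem_interior by blast
  have "0 \<in> closure ?W" using I closure by (intro zero_in_closure_sum_scaled) auto
  then obtain s where s: "s \<in> ?W" "norm s < w j * r / 2"
    unfolding closure_approachable using r w by (metis dist_0_norm dist_commute half_gt_zero mult_pos_pos)
  have "ball 0 (w j * r / 2) \<subseteq> (*\<^sub>R) (w j) ` S j + ?W"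
  proof
    fix x :: 'a assume x: "x \<in> ball 0 (w j * r / 2)"
    have "norm (x - s) < w j * r" using norm_triangle_ineq4[of x s] x s(2) by simp
    moreover have "norm ((x - s) /\<^sub>R w j) = norm (x - s) / w j"
      using w by (simp add: divide_inverse mult.commute)
    ultimately have "norm ((x - s) /\<^sub>R w j) < r" using w by (simp add: pos_divide_less_eq mult.commute)
    then have "(x - s) /\<^sub>R w j \<in> S j" using r(2) by auto
    then have "x - s \<in> (*\<^sub>R) (w j) ` S j"
      using w by (intro image_eqI[of _ _ "(x - s) /\<^sub>R w j"]) auto
    from set_plus_intro[OF this s(1)] show "x \<in> (*\<^sub>R) (w j) ` S j + ?W" by simp
  qed
  also have "\<dots> = (\<Sum>i\<in>I. (*\<^sub>R) (w i) ` S i)" using I by (simp add: sum.remove)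
  finally show ?thesis using r(1) w by (auto simp: mem_interior intro!: exI[of _ "w j * r / 2"])
qed

lemma sum_scaled_eq_UNIV:
  fixes S :: "'i \<Rightarrow> 'a::real_vector set"
  assumes I: "finite I" "j \<in> I" and w: "w j \<noteq> 0"
    and j: "S j = UNIV" and nonempty: "\<And>i. i \<in> I \<Longrightarrow> S i \<noteq> {}"
  shows "(\<Sum>i\<in>I. (*\<^sub>R) (w i) ` S i) = UNIV"
proof -
  have "\<forall>i\<in>I. \<exists>x. x \<in> S i" using nonempty by blast
  then obtain s where s: "\<And>i. i \<in> I \<Longrightarrow> s i \<in> S i" by metis
  have "x \<in> (\<Sum>i\<in>I. (*\<^sub>R) (w i) ` S i)" for x
  proof -
    define t where "t = s(j := (x - (\<Sum>i\<in>I - {j}. w i *\<^sub>R s i)) /\<^sub>R w j)"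
    have "(\<Sum>i\<in>I. w i *\<^sub>R t i) = w j *\<^sub>R t j + (\<Sum>i\<in>I - {j}. w i *\<^sub>R s i)"
      using I by (simp add: sum.remove t_def)
    also have "\<dots> = x" using w by (simp add: t_def)
    finally have "x = (\<Sum>i\<in>I. w i *\<^sub>R t i)" ..
    moreover have "\<forall>i\<in>I. t i \<in> S i" using s j by (simp add: t_def)
    ultimately show ?thesis unfolding mem_sum_scaled_images_iff[OF I(1)] by blast
  qed
  then show ?thesis by blast
qed

section \<open>The resolvent average\<close>

theorem corollary4p14:
  fixes m j :: nat
    and I :: "nat set"
    and As :: "nat \<Rightarrow> 'a::euclidean_space \<Rightarrow> 'a set"
    and w :: "nat \<Rightarrow> real"
    and A :: "'a \<Rightarrow> 'a set"
  assumes "m \<ge> 1"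
    and "I = {1..m}"
    and "\<And>i. i \<in> I \<Longrightarrow> maximally_monotone (As i)"
    and "\<And>i. i \<in> I \<Longrightarrow> w i > 0"
    and "(\<Sum>i\<in>I. w i) = 1"
    and "j \<in> I"
    and "A = resolvent_average I w As"
  shows "maximally_monotone A
    \<and> nearly_equal (op_dom A) (\<Sum>i\<in>I. (*\<^sub>R) (w i) ` op_dom (As i))
    \<and> nearly_equal (op_ran A) (\<Sum>i\<in>I. (*\<^sub>R) (w i) ` op_ran (As i))
    \<and> (0 \<in> (\<Inter>i\<in>I. closure (op_ran (As i))) \<longrightarrow> 0 \<in> closure (op_ran A))
    \<and> (0 \<in> interior (op_ran (As j)) \<inter> (\<Inter>i\<in>I - {j}. closure (op_ran (As i)))
           \<longrightarrow> 0 \<in> interior (op_ran A))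
    \<and> (op_dom (As j) = UNIV \<longrightarrow> op_dom A = UNIV)
    \<and> (op_ran (As j) = UNIV \<longrightarrow> op_ran A = UNIV)"
proof -
  have fin: "finite I" and w0: "\<And>i. i \<in> I \<Longrightarrow> w i \<ge> 0"
    using assms(2,4) by (auto intro: less_imp_le)
  have "\<forall>i\<in>I. \<exists>T. firmly_nonexpansive T \<and> As i = operator_of_resolvent T"
    using Minty[OF assms(3)] by metis
  then obtain T where T: "\<And>i. i \<in> I \<Longrightarrow> firmly_nonexpansive (T i)"
      and As: "\<And>i. i \<in> I \<Longrightarrow> As i = operator_of_resolvent (T i)"
    by metis
  define J where "J x = (\<Sum>i\<in>I. w i *\<^sub>R T i x)" for x
  have "resolvent_average I w As = resolvent_average I w (\<lambda>i. operator_of_resolvent (T i))"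
    using As by (simp add: resolvent_average_def op_sum_def)
  then have A: "A = operator_of_resolvent J"
    by (simp add: assms(7) J_def[abs_def] resolvent_average_operator_of_resolvent[OF fin])
  have J: "firmly_nonexpansive J"
    using firmly_nonexpansive_convex_combination[OF w0 assms(5) T] by (simp add: J_def[abs_def])
  \<comment> \<open>As the weights sum to \<open>1\<close>, the complement of \<open>J\<close> is the same convex combination of the complements,
    which reduces the range to the situation of the domain.\<close>
  have complement: "x - J x = (\<Sum>i\<in>I. w i *\<^sub>R (x - T i x))" for x
    using assms(5) by (simp add: J_def scaleR_diff_right sum_subtractf flip: scaleR_left.sum)
  have maximal: "maximally_monotone A"
    unfolding A by (rule maximally_monotone_operator_of_resolvent[OF J])
  have dom: "nearly_equal (op_dom A) (\<Sum>i\<in>I. (*\<^sub>R) (w i) ` op_dom (As i))"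
    using range_convex_combination_nearly_equal[OF fin w0 assms(5) T]
    by (simp add: A As op_dom_operator_of_resolvent J_def[abs_def])
  have ran: "nearly_equal (op_ran A) (\<Sum>i\<in>I. (*\<^sub>R) (w i) ` op_ran (As i))"
    using range_convex_combination_nearly_equal[OF fin w0 assms(5), of "\<lambda>i x. x - T i x"]
      firmly_nonexpansive_complement[OF T]
    by (simp add: A As op_ran_operator_of_resolvent complement)
  have nonempty: "op_dom (As i) \<noteq> {}" "op_ran (As i) \<noteq> {}" if "i \<in> I" for i
    using As[OF that] by (simp_all add: op_dom_operator_of_resolvent op_ran_operator_of_resolvent)
  have "0 \<in> closure (op_ran A)" if "0 \<in> (\<Inter>i\<in>I. closure (op_ran (As i)))"
    using zero_in_closure_sum_scaled[OF fin, of "\<lambda>i. op_ran (As i)" w] that ran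
    by (simp add: nearly_equal_def)
  moreover have "0 \<in> interior (op_ran A)"
    if "0 \<in> interior (op_ran (As j)) \<inter> (\<Inter>i\<in>I - {j}. closure (op_ran (As i)))"
  proof -
    have "0 \<in> interior (\<Sum>i\<in>I. (*\<^sub>R) (w i) ` op_ran (As i))"
      by (rule zero_in_interior_sum_scaled[of I j]) (use that fin assms(4,6) in auto)
    then show ?thesis using interior_subset_if_nearly_equal[OF ran] by blast
  qed
  moreover have "op_dom A = UNIV" if "op_dom (As j) = UNIV"
  proof (rule eq_UNIV_if_nearly_equal_UNIV)
    have "(\<Sum>i\<in>I. (*\<^sub>R) (w i) ` op_dom (As i)) = UNIV"
      using fin assms(4,6) that nonempty(1) by (intro sum_scaled_eq_UNIV[of I j]) force+
    with dom show "nearly_equal (op_dom A) UNIV" by simp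
  qed
  moreover have "op_ran A = UNIV" if "op_ran (As j) = UNIV"
  proof (rule eq_UNIV_if_nearly_equal_UNIV)
    have "(\<Sum>i\<in>I. (*\<^sub>R) (w i) ` op_ran (As i)) = UNIV"
      using fin assms(4,6) that nonempty(2) by (intro sum_scaled_eq_UNIV[of I j]) force+
    with ran show "nearly_equal (op_ran A) UNIV" by simp
  qed
  ultimately show ?thesis using maximal dom ran by blast
qed

end
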